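(* Let $d \geq 4$, let $\alpha := \frac{1}{2^{d-2}-1}$, and let \[ \Delta(d) := \Big\{x \in \mathbb{R}^d : x_i \geq 0 \ (1 \leq i \leq d),\ \frac{x_1}{2} + \frac{x_2}{4} + \dots + \frac{x_{d-2}}{2^{d-2}} + \frac{x_{d-1}}{2^{d-1}-1} + \frac{x_d}{2^{d-1}+1+\alpha} \leq 1\Big\}, \] which equals $\mathrm{conv}\{0, 2e_1, 4e_2, \dots, 2^{d-2}e_{d-2}, (2^{d-1}-1)e_{d-1}, (2^{d-1}+1+\alpha)e_d\}$. Let $\Delta(d)_I := \mathrm{conv}(\Delta(d) \cap \mathbb{Z}^d)$. Then \[ \Delta(d)_I = \Big\{x \in \mathbb{R}^d : x_i \geq 0 \ (1 \leq i \leq d),\ \frac{x_1}{2} + \dots + \frac{x_{d-2}}{2^{d-2}} + \frac{x_{d-1}}{2^{d-1}-1} + \frac{x_d}{2^{d-1}+1+\alpha} \leq 1,\ \frac{x_1}{2} + \dots + \frac{x_{d-3}}{2^{d-3}} + \frac{2x_{d-2} + x_{d-1} + x_d}{2^{d-1}+1} \leq 1 \Big\} \] \[ = \mathrm{conv}\{0, 2e_1, 4e_2, \dots, 2^{d-2}e_{d-2}, (2^{d-1}-1)e_{d-1}, (2^{d-1}+1)e_d, e_{d-1} + 2^{d-1}e_d, e_{d-2} + (2^{d-1}-1)e_d\}. \] This polytope is a $(d-3)$-fold pyramid over a triangular prism. Moreover, $\Delta(d)_I$ is a hollow lattice polytope, it is not properly contained in any larger hollow $d$-dimensional lattice polytope,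 and it is properly contained in the hollow convex body $\Delta(d)$.
   Context: $e_1,\dots,e_d$ denote the standard unit vectors of $\mathbb{R}^d$. A lattice polytope is the convex hull of finitely many points of $\mathbb{Z}^d$. A convex body is hollow if its interior contains no point of $\mathbb{Z}^d$. *)

theory Defs
  imports "HOL-Analysis.Analysis"
begin

definition int_lattice :: "(real ^ 'n) set" where
  "int_lattice = {x. \<forall>i. x $ i \<in> \<int>}"

definition lattice_polytope :: "(real ^ 'n) set \<Rightarrow> bool" where
  "lattice_polytope P \<longleftrightarrow> (\<exists>S. finite S \<and> S \<subseteq> int_lattice \<and> P = convex hull S)"

definition convex_body :: "(real ^ 'n) set \<Rightarrow> bool" where
  "convex_body K \<longleftrightarrow> convex K \<and> compact K \<and> interior K \<noteq> {}"

definition hollow :: "(real ^ 'n) set \<Rightarrow> bool" where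
  "hollow K \<longleftrightarrow> interior K \<inter> int_lattice = {}"

definition integer_hull :: "(real ^ 'n) set \<Rightarrow> (real ^ 'n) set" where
  "integer_hull K = convex hull (K \<inter> int_lattice)"

(* Isomorphism of face lattices; face_of admits {} and the whole set as faces. *)
definition combinatorially_equivalent :: "'a::real_vector set \<Rightarrow> 'b::real_vector set \<Rightarrow> bool" where
  "combinatorially_equivalent P Q \<longleftrightarrow>
     (\<exists>f. bij_betw f {F. F face_of P} {G. G face_of Q} \<and>
          (\<forall>F F'. F face_of P \<longrightarrow> F' face_of P \<longrightarrow> (F \<subseteq> F' \<longleftrightarrow> f F \<subseteq> f F')))"

(* Prisms are meant combinatorially: the two triangles need not be parallel or congruent. *)
definition triangular_prism :: "'a::euclidean_space set \<Rightarrow> bool" where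
  "triangular_prism Q \<longleftrightarrow> polytope Q \<and>
     combinatorially_equivalent Q
       ((convex hull {(0, 0), (1, 0), (0, 1)} :: (real \<times> real) set) \<times> {0..1::real})"

inductive iterated_pyramid :: "nat \<Rightarrow> 'a::euclidean_space set \<Rightarrow> 'a set \<Rightarrow> bool" where
  base: "iterated_pyramid 0 Q Q"
| apex: "iterated_pyramid k Q P \<Longrightarrow> a \<notin> affine hull P \<Longrightarrow>
           iterated_pyramid (Suc k) Q (convex hull (insert a P))"

(* Throughout, e 1, ..., e d lists the standard unit vectors, so that inner x (e i) is the
   i-th coordinate of x; the order of the listing matters for the sets below. *)

definition alpha :: "nat \<Rightarrow> real" where
  "alpha d = 1 / (2 ^ (d - 2) - 1)"

definition Delta :: "nat \<Rightarrow> (nat \<Rightarrow> real ^ 'n) \<Rightarrow> (real ^ 'n) set" where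
  "Delta d e = {x. (\<forall>i\<in>{1..d}. 0 \<le> x \<bullet> e i) \<and>
     (\<Sum>i = 1..d - 2. (x \<bullet> e i) / 2 ^ i) + (x \<bullet> e (d - 1)) / (2 ^ (d - 1) - 1)
       + (x \<bullet> e d) / (2 ^ (d - 1) + 1 + alpha d) \<le> 1}"

end

theory Submission imports Defs begin

text \<open>Put \<open>M = 2 ^ (d - 2)\<close>. The last axis vertex of \<^const>\<open>Delta\<close> has height
  \<open>M (2 M - 1) / (M - 1)\<close>, which makes the all-ones vector lie on the oblique facet; as an interior
  lattice point would dominate it, \<^const>\<open>Delta\<close> is hollow. For a lattice point, the slack
  \<open>M - M (x_1 / 2 + ... + x_(d-3) / 2 ^ (d-3))\<close> is congruent to \<open>M\<close> modulo 2, and rounding yields the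
  second inequality; conversely the truncated simplex is an iterated pyramid over a truncated
  tetrahedron, where convex combinations can be written down. This tetrahedron is a projective image
  of the standard prism, and projective maps preserve segments, hence faces. Finally, every facet of
  the truncated simplex except the truncating one has a lattice point in its relative interior
  (the all-ones vector, or that vector minus a unit vector), and a lattice point that violates only
  the truncating inequality lies in \<^const>\<open>Delta\<close>, hence in its integer hull.\<close>

section \<open>Segment-preserving maps and faces\<close>

lemma convex_image_closed_segment:
  assumes "convex C"
    and seg: "\<And>a b. a \<in> C \<Longrightarrow> b \<in> C \<Longrightarrow>
      f ` closed_segment a b = closed_segment (f a) (f b)"
  shows "convex (f ` C)"
  unfolding convex_contains_segment
proof (intro ballI)
  fix y z assume "y \<in> f ` C" "z \<in> f ` C"
  then obtain a b where ab: "a \<in> C" "b \<in> C" "y = f a" "z = f b"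
    by blast
  then have "closed_segment y z = f ` closed_segment a b"
    by (simp add: seg)
  also have "\<dots> \<subseteq> f ` C"
    using ab assms(1) by (intro image_mono) (simp add: closed_segment_subset)
  finally show "closed_segment y z \<subseteq> f ` C" .
qed

lemma convex_vimage_closed_segment:
  assumes "convex C" "convex D"
    and seg: "\<And>a b. a \<in> C \<Longrightarrow> b \<in> C \<Longrightarrow>
      f ` closed_segment a b = closed_segment (f a) (f b)"
  shows "convex (C \<inter> f -` D)"
  unfolding convex_contains_segment
proof (intro ballI subsetI)
  fix a b x assume *: "a \<in> C \<inter> f -` D" "b \<in> C \<inter> f -` D" "x \<in> closed_segment a b"
  then have "f x \<in> closed_segment (f a) (f b)"
    using seg[of a b] by blast
  moreover have "closed_segment (f a) (f b) \<subseteq> D"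
    using * assms(2) by (simp add: closed_segment_subset)
  moreover have "closed_segment a b \<subseteq> C"
    using * assms(1) by (simp add: closed_segment_subset)
  ultimately show "x \<in> C \<inter> f -` D"
    using * by auto
qed

text \<open>Each inclusion is minimality of a hull, because a segment-preserving map has convex
  preimages and convex images of convex sets.\<close>

lemma convex_hull_image_closed_segment:
  assumes seg: "\<And>a b. a \<in> convex hull S \<Longrightarrow> b \<in> convex hull S \<Longrightarrow>
      f ` closed_segment a b = closed_segment (f a) (f b)"
  shows "f ` (convex hull S) = convex hull (f ` S)"
proof
  have "convex hull S \<subseteq> convex hull S \<inter> f -` (convex hull (f ` S))"
  proof (rule hull_minimal)
    show "S \<subseteq> convex hull S \<inter> f -` (convex hull (f ` S))"
      by (auto intro: hull_inc)
    show "convex (convex hull S \<inter> f -` (convex hull (f ` S)))"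
      by (rule convex_vimage_closed_segment) (auto simp: seg)
  qed
  then show "f ` (convex hull S) \<subseteq> convex hull (f ` S)"
    by auto
  show "convex hull (f ` S) \<subseteq> f ` (convex hull S)"
    by (intro hull_minimal image_mono hull_subset convex_image_closed_segment convex_convex_hull seg)
qed

text \<open>Faces are defined through open segments alone. Injectivity lets \<open>f\<close> respect
  the removal of endpoints, so it maps open segments onto open segments, and image and preimage are
  mutually inverse maps between the faces.\<close>

lemma combinatorially_equivalent_image:
  assumes C: "convex C" and inj: "inj_on f C"
    and seg: "\<And>a b. a \<in> C \<Longrightarrow> b \<in> C \<Longrightarrow>
      f ` closed_segment a b = closed_segment (f a) (f b)"
  shows "combinatorially_equivalent (f ` C) C"
proof -
  have oseg: "f ` open_segment a b = open_segment (f a) (f b)" if "a \<in> C" "b \<in> C" for a b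
  proof -
    have "closed_segment a b \<subseteq> C"
      using that C by (simp add: closed_segment_subset)
    then have "f ` open_segment a b = f ` closed_segment a b - f ` {a, b}"
      unfolding open_segment_def using that
      by (intro inj_on_image_set_diff[OF inj]) auto
    then show ?thesis
      by (simp add: seg[OF that] open_segment_def)
  qed
  have image_face: "f ` F face_of f ` C" if F: "F face_of C" for F
    unfolding face_of_def
  proof (intro conjI ballI impI)
    have FC: "F \<subseteq> C" and "convex F"
      using F by (auto simp: face_of_def)
    then show "f ` F \<subseteq> f ` C" "convex (f ` F)"
      using convex_image_closed_segment[of F f] seg by blast+
    fix a b x
    assume "a \<in> f ` C" "b \<in> f ` C" "x \<in> f ` F" and x: "x \<in> open_segment a b"
    then obtain a' b' x' where *: "a' \<in> C" "b' \<in> C" "x' \<in> F" "a = f a'" "b = f b'" "x = f x'"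
      by blast
    \<comment> \<open>The point of the segment over \<open>x\<close> need not be \<open>x'\<close>
      at first; it lies in \<open>C\<close> by convexity, so injectivity identifies the two.\<close>
    then obtain x'' where x'': "x'' \<in> open_segment a' b'" "f x' = f x''"
      using oseg x by blast
    moreover have "x'' \<in> C"
      using x'' * C by (meson convex_contains_open_segment subsetD)
    ultimately have "x' \<in> open_segment a' b'"
      using inj * FC by (metis inj_onD subsetD)
    then have "a' \<in> F" "b' \<in> F"
      using F * by (auto simp: face_of_def)
    then show "a \<in> f ` F" "b \<in> f ` F"
      using * by auto
  qed
  have vimage_face: "C \<inter> f -` G face_of C" if G: "G face_of f ` C" for G
    unfolding face_of_def
  proof (intro conjI ballI impI)
    show "C \<inter> f -` G \<subseteq> C" by blast
    show "convex (C \<inter> f -` G)"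
      using G C by (intro convex_vimage_closed_segment) (auto simp: seg face_of_def)
    fix a b x
    assume *: "a \<in> C" "b \<in> C" "x \<in> C \<inter> f -` G" "x \<in> open_segment a b"
    then have "f x \<in> open_segment (f a) (f b)"
      using oseg by blast
    then have "f a \<in> G" "f b \<in> G"
      using G * by (auto simp: face_of_def)
    then show "a \<in> C \<inter> f -` G" "b \<in> C \<inter> f -` G"
      using * by auto
  qed
  have im_vim: "f ` (C \<inter> f -` G) = G" if "G face_of f ` C" for G
    using face_of_imp_subset[OF that] by auto
  have vim_im: "C \<inter> f -` (f ` F) = F" if "F face_of C" for F
    using face_of_imp_subset[OF that] inj by (auto dest: inj_onD)
  show ?thesis
    unfolding combinatorially_equivalent_def
  proof (intro exI[of _ "\<lambda>G. C \<inter> f -` G"] conjI allI impI)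
    show "bij_betw (\<lambda>G. C \<inter> f -` G) {G. G face_of f ` C} {F. F face_of C}"
      by (rule bij_betw_byWitness[where f' = "(`) f"])
        (auto simp: im_vim vim_im image_face vimage_face)
    fix F G assume "F face_of f ` C" "G face_of f ` C"
    then show "F \<subseteq> G \<longleftrightarrow> C \<inter> f -` F \<subseteq> C \<inter> f -` G"
      using im_vim[of F] im_vim[of G] by blast
  qed
qed

text \<open>Dividing by a positive affine function only reparametrises the segment: the parameter
  \<open>t\<close> becomes \<open>t * l b / ((1 - t) * l a + t * l b)\<close>, which is a bijection
  of the unit interval.\<close>

lemma projective_image_closed_segment:
  fixes L :: "'a::real_vector \<Rightarrow> 'b::real_vector" and l :: "'a \<Rightarrow> real"
  assumes L: "\<And>t. L ((1 - t) *\<^sub>R a + t *\<^sub>R b) = (1 - t) *\<^sub>R L a + t *\<^sub>R L b"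
    and l: "\<And>t. l ((1 - t) *\<^sub>R a + t *\<^sub>R b) = (1 - t) * l a + t * l b"
    and pos: "l a > 0" "l b > 0"
  shows "(\<lambda>x. L x /\<^sub>R l x) ` closed_segment a b = closed_segment (L a /\<^sub>R l a) (L b /\<^sub>R l b)"
proof -
  have *: "(1 - t) * p + t * q > 0" if "0 \<le> t" "t \<le> 1" "p > 0" "q > 0" for t p q :: real
    using that by (cases "t = 1") (auto intro!: add_pos_nonneg)
  have eq: "L ((1 - t) *\<^sub>R a + t *\<^sub>R b) /\<^sub>R l ((1 - t) *\<^sub>R a + t *\<^sub>R b)
      = (1 - s) *\<^sub>R (L a /\<^sub>R l a) + s *\<^sub>R (L b /\<^sub>R l b)"
    if "s * ((1 - t) * l a + t * l b) = t * l b" "(1 - t) * l a + t * l b > 0" for s t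
  proof -
    define D where "D = (1 - t) * l a + t * l b"
    have D: "D > 0" and s: "s = t * l b / D"
      using that by (auto simp: D_def field_simps)
    have "D - t * l b = (1 - t) * l a"
      by (simp add: D_def)
    then have "1 - s = (1 - t) * l a / D"
      using D unfolding s by (metis diff_divide_distrib divide_self_if less_irrefl)
    then have "(1 - s) / l a = (1 - t) / D" "s / l b = t / D"
      using pos D by (auto simp: s)
    then show ?thesis
      unfolding L l D_def[symmetric] scaleR_add_right scaleR_scaleR
      by (metis divide_inverse mult.commute)
  qed
  show ?thesis
  proof (intro equalityI subsetI)
    fix y assume "y \<in> (\<lambda>x. L x /\<^sub>R l x) ` closed_segment a b"
    then obtain t where t: "0 \<le> t" "t \<le> 1"
      and y: "y = L ((1 - t) *\<^sub>R a + t *\<^sub>R b) /\<^sub>R l ((1 - t) *\<^sub>R a + t *\<^sub>R b)"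
      by (auto simp: in_segment)
    define s where "s = t * l b / ((1 - t) * l a + t * l b)"
    have D: "(1 - t) * l a + t * l b > 0"
      using * t pos by blast
    have "0 \<le> s" "s \<le> 1"
      using D t pos by (auto simp: s_def divide_le_eq_1)
    moreover have "y = (1 - s) *\<^sub>R (L a /\<^sub>R l a) + s *\<^sub>R (L b /\<^sub>R l b)"
      unfolding y using D by (intro eq) (auto simp: s_def)
    ultimately show "y \<in> closed_segment (L a /\<^sub>R l a) (L b /\<^sub>R l b)"
      unfolding in_segment by blast
  next
    fix y assume "y \<in> closed_segment (L a /\<^sub>R l a) (L b /\<^sub>R l b)"
    then obtain s where s: "0 \<le> s" "s \<le> 1"
      and y: "y = (1 - s) *\<^sub>R (L a /\<^sub>R l a) + s *\<^sub>R (L b /\<^sub>R l b)"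
      by (auto simp: in_segment)
    \<comment> \<open>The inverse reparametrisation has the same form, with \<open>l a\<close> and
      \<open>l b\<close> exchanged.\<close>
    define E where "E = (1 - s) * l b + s * l a"
    define t where "t = s * l a / E"
    have E: "E > 0"
      using * s pos by (simp add: E_def)
    have t: "0 \<le> t" "t \<le> 1"
      using E s pos by (auto simp: t_def divide_le_eq_1 E_def)
    have "s * ((1 - t) * l a + t * l b) = t * l b"
    proof -
      have "t * E = s * l a"
        using E by (simp add: t_def)
      then show ?thesis
        by (simp add: E_def algebra_simps)
    qed
    moreover have "(1 - t) * l a + t * l b > 0"
      using * t pos by blast
    ultimately have "y = L ((1 - t) *\<^sub>R a + t *\<^sub>R b) /\<^sub>R l ((1 - t) *\<^sub>R a + t *\<^sub>R b)"
      unfolding y using eq by simp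
    moreover have "(1 - t) *\<^sub>R a + t *\<^sub>R b \<in> closed_segment a b"
      using t by (auto simp: in_segment)
    ultimately show "y \<in> (\<lambda>x. L x /\<^sub>R l x) ` closed_segment a b"
      by blast
  qed
qed

section \<open>Scaled convex sets\<close>

text \<open>This allows a convex combination to be built up summand by summand: the weights are
  added along the way, and only their total has to be 1 in the end.\<close>

lemma scaleR_image_add:
  fixes C :: "'a::real_vector set"
  assumes "convex C" "0 \<le> s" "0 \<le> t" "x \<in> (*\<^sub>R) s ` C" "y \<in> (*\<^sub>R) t ` C"
  shows "x + y \<in> (*\<^sub>R) (s + t) ` C"
proof -
  obtain a b where ab: "a \<in> C" "b \<in> C" "x = s *\<^sub>R a" "y = t *\<^sub>R b"
    using assms by blast
  show ?thesis
  proof (cases "s + t = 0")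
    case True
    then have "s = 0" "t = 0"
      using assms by auto
    then show ?thesis
      using ab by auto
  next
    case False
    then have "s + t > 0"
      using assms by auto
    then have "x + y = (s + t) *\<^sub>R ((s / (s + t)) *\<^sub>R a + (t / (s + t)) *\<^sub>R b)"
      by (simp add: scaleR_add_right ab)
    moreover have "(s / (s + t)) *\<^sub>R a + (t / (s + t)) *\<^sub>R b \<in> C"
      using assms ab \<open>s + t > 0\<close>
      by (intro convexD) (auto simp: add_divide_distrib[symmetric])
    ultimately show ?thesis by blast
  qed
qed

lemma scaleR_image_sum:
  fixes C :: "'a::real_vector set"
  assumes "convex C" "C \<noteq> {}" "finite I"
    and "\<And>i. i \<in> I \<Longrightarrow> 0 \<le> w i" "\<And>i. i \<in> I \<Longrightarrow> p i \<in> C"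
  shows "(\<Sum>i\<in>I. w i *\<^sub>R p i) \<in> (*\<^sub>R) (\<Sum>i\<in>I. w i) ` C"
  using assms(3-5)
proof (induction I rule: finite_induct)
  case empty
  then show ?case
    using assms(2) by auto
next
  case (insert i I)
  then show ?case
    using assms(1) by (auto intro!: scaleR_image_add sum_nonneg)
qed

section \<open>Coordinates\<close>

text \<open>From an interior point a short step along \<open>w\<close> stays in \<open>S\<close> and
  increases \<open>f\<close>, so the bound cannot be attained.\<close>

lemma linear_less_of_interior:
  fixes f :: "'a::real_normed_vector \<Rightarrow> real"
  assumes f: "linear f" and w: "f w > 0" and x: "x \<in> interior S"
    and le: "\<And>z. z \<in> S \<Longrightarrow> f z \<le> c"
  shows "f x < c"
proof -
  obtain r where r: "r > 0" "ball x r \<subseteq> S"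
    using x by (auto simp: mem_interior)
  have "w \<noteq> 0"
    using w linear_0[OF f] by auto
  define t where "t = r / (2 * norm w)"
  have "t > 0" "norm (t *\<^sub>R w) < r"
    using r \<open>w \<noteq> 0\<close> by (auto simp: t_def)
  then have "x + t *\<^sub>R w \<in> S"
    using r by (auto simp: dist_norm)
  then have "f x + t * f w \<le> c"
    using le linear_add[OF f] linear_scale[OF f] by force
  then show ?thesis
    using mult_pos_pos[OF \<open>t > 0\<close> w] by linarith
qed

declare One_nat_def [simp del]

lemma sum_inverse_powers: "(\<Sum>i = 1..n. 1 / 2 ^ i) = 1 - 1 / (2::real) ^ n"
  by (induction n) (auto simp: field_simps)

text \<open>Here \<open>a\<close> plays the slack of an inequality at a point and \<open>b\<close>
  its rate of change along a ray.\<close>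

lemma eventually_perturbation_pos:
  fixes a b :: real
  assumes "0 < a \<or> a = 0 \<and> 0 < b"
  shows "\<forall>\<^sub>F t in at_right 0. 0 < a + t * b"
proof (cases "0 < a")
  case True
  have "((\<lambda>t. a + t * b) \<longlongrightarrow> a + 0 * b) (at_right 0)"
    by (intro tendsto_intros)
  then show ?thesis
    using True by (intro order_tendstoD(1)) auto
next
  case False
  then show ?thesis
    using assms eventually_at_right_less[of "0::real"]
    by (auto elim!: eventually_mono)
qed

text \<open>The rounding argument. With \<open>k = N - 2 * m\<close> and
  \<open>w = 2 * y + u + v\<close> the hypothesis gives \<open>w \<le> 2 * k + k / (N - 1)\<close>
  over the reals. For \<open>m = 0\<close> this is below \<open>2 * N + 2\<close>, so
  \<open>w \<le> 2 * N + 1\<close>; otherwise the fraction is below 1, so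
  \<open>w \<le> 2 * k\<close>.\<close>

lemma tail_integer_bound:
  fixes N y u v m :: int
  assumes N: "4 \<le> N" and nonneg: "0 \<le> y" "0 \<le> u" "0 \<le> v" "0 \<le> m"
    and le: "(2 * N - 1) * y + N * u + (N - 1) * v \<le> (2 * N - 1) * (N - 2 * m)"
  shows "N * (2 * y + u + v) \<le> (2 * N + 1) * (N - 2 * m)"
proof -
  define k w where "k = N - 2 * m" and "w = 2 * y + u + v"
  have "0 \<le> (2 * N - 1) * y" "0 \<le> N * u" "0 \<le> (N - 1) * v"
    using N nonneg by auto
  then have "0 \<le> (2 * N - 1) * k"
    using le unfolding k_def by linarith
  then have "0 \<le> k"
    using N by (simp add: zero_le_mult_iff)
  \<comment> \<open>The left side is that of the hypothesis, regrouped.\<close>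
  have "(N - 1) * w + u + y \<le> (2 * N - 1) * k"
    using le by (simp add: w_def k_def algebra_simps)
  then have w: "(N - 1) * w \<le> (2 * N - 1) * k"
    using nonneg by linarith
  show ?thesis
  proof (cases "m = 0")
    case True
    then have "(N - 1) * w \<le> (2 * N - 1) * N"
      using w by (simp add: k_def)
    also have "\<dots> < (N - 1) * (2 * N + 2)"
      using N by (simp add: algebra_simps)
    finally have "w < 2 * N + 2"
      using N by simp
    then have "N * w \<le> N * (2 * N + 1)"
      using N by (intro mult_left_mono) auto
    then show ?thesis
      using True by (simp add: w_def mult.commute)
  next
    case False
    \<comment> \<open>This is where parity matters: \<open>k\<close> drops from \<open>N\<close> in
      steps of 2 and skips \<open>N - 1\<close>.\<close>
    then have "k < N - 1"
      using nonneg by (simp add: k_def)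
    then have "(2 * N - 1) * k < (N - 1) * (2 * k + 1)"
      by (simp add: algebra_simps)
    then have "(N - 1) * w < (N - 1) * (2 * k + 1)"
      using w by linarith
    then have "w < 2 * k + 1"
      using N by simp
    then have "N * w \<le> N * (2 * k)"
      using N by (intro mult_left_mono) auto
    also have "\<dots> \<le> (2 * N + 1) * k"
      using \<open>0 \<le> k\<close> by (simp add: algebra_simps)
    finally show ?thesis
      by (simp add: w_def k_def)
  qed
qed

section \<open>The two oblique facets as linear functionals\<close>

locale basis_listing =
  fixes d :: nat and e :: "nat \<Rightarrow> real ^ 'n"
  assumes d_ge: "4 \<le> d" and e_bij: "bij_betw e {1..d} Basis"
begin

definition M :: real where "M = 2 ^ (d - 2)"

lemma M_ge: "4 \<le> M"
proof -
  have "(2::real) ^ 2 \<le> 2 ^ (d - 2)"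
    using d_ge by (intro power_increasing) auto
  then show ?thesis
    by (simp add: M_def)
qed

lemma pow_d1: "(2::real) ^ (d - 1) = 2 * M"
proof -
  have "d - 1 = Suc (d - 2)"
    using d_ge by simp
  then show ?thesis
    by (simp add: M_def)
qed

lemma pow_d3: "(2::real) ^ (d - 3) = M / 2"
proof -
  have "d - 2 = Suc (d - 3)"
    using d_ge by simp
  then show ?thesis
    by (simp add: M_def)
qed

lemma last_axis_bound: "2 ^ (d - 1) + 1 + alpha d = M * (2 * M - 1) / (M - 1)"
  using M_ge by (simp add: alpha_def pow_d1 M_def[symmetric] field_simps)

lemma inner_e: "i \<in> {1..d} \<Longrightarrow> j \<in> {1..d} \<Longrightarrow> e i \<bullet> e j = of_bool (i = j)"
  using bij_betwE[OF e_bij] bij_betw_imp_inj_on[OF e_bij]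
  by (auto simp: inner_Basis inj_on_eq_iff)

lemma e_expansion: "(\<Sum>i = 1..d. (x \<bullet> e i) *\<^sub>R e i) = x"
  using sum.reindex_bij_betw[OF e_bij, of "\<lambda>b. (x \<bullet> b) *\<^sub>R b"]
  by (simp add: euclidean_representation)

lemma int_lattice_iff: "x \<in> int_lattice \<longleftrightarrow> (\<forall>i\<in>{1..d}. x \<bullet> e i \<in> \<int>)"
proof -
  have "x \<in> int_lattice \<longleftrightarrow> (\<forall>b\<in>Basis. x \<bullet> b \<in> \<int>)"
    by (simp add: int_lattice_def Basis_vec_def inner_axis)
  also have "\<dots> \<longleftrightarrow> (\<forall>i\<in>{1..d}. x \<bullet> e i \<in> \<int>)"
    using bij_betw_imp_surj_on[OF e_bij] by (metis (no_types, lifting) imageE imageI)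
  finally show ?thesis .
qed

lemma atLeastAtMost_d: "{1..d} = {1..d - 3} \<union> {d - 2, d - 1, d}"
  using d_ge by auto

lemma sum_d: "(\<Sum>i = 1..d. f i) = (\<Sum>i = 1..d - 3. f i) + f (d - 2) + f (d - 1) + f d"
  for f :: "nat \<Rightarrow> 'b::comm_monoid_add"
proof -
  have "(\<Sum>i = 1..d. f i) = (\<Sum>i = 1..d - 3. f i) + (\<Sum>i\<in>{d - 2, d - 1, d}. f i)"
    unfolding atLeastAtMost_d using d_ge by (intro sum.union_disjoint) auto
  moreover have "d - 2 \<noteq> d - 1" "d - 2 \<noteq> d" "d - 1 \<noteq> d"
    using d_ge by auto
  ultimately show ?thesis
    by (simp add: add.assoc)
qed

text \<open>The contribution of the first \<open>d - 3\<close> coordinates, which is common to both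
  oblique inequalities.\<close>

definition head :: "real ^ 'n \<Rightarrow> real" where
  "head x = (\<Sum>i = 1..d - 3. (x \<bullet> e i) / 2 ^ i)"

definition first :: "real ^ 'n \<Rightarrow> real" where
  "first x = head x + (x \<bullet> e (d - 2)) / M + (x \<bullet> e (d - 1)) / (2 * M - 1)
     + (M - 1) * (x \<bullet> e d) / (M * (2 * M - 1))"

definition second :: "real ^ 'n \<Rightarrow> real" where
  "second x = head x + (2 * (x \<bullet> e (d - 2)) + x \<bullet> e (d - 1) + x \<bullet> e d) / (2 * M + 1)"

lemma linear_head: "linear head"
  unfolding head_def
  by (intro linearI) (simp_all add: inner_add_left add_divide_distrib sum.distrib sum_distrib_left)

lemma linear_first: "linear first"
proof (rule linearI)
  show "first (x + y) = first x + first y" for x y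
    by (simp add: first_def linear_add[OF linear_head] inner_add_left add_divide_distrib distrib_left)
  show "first (c *\<^sub>R x) = c *\<^sub>R first x" for c x
    by (simp add: first_def linear_scale[OF linear_head] distrib_left mult.left_commute)
qed

lemma linear_second: "linear second"
proof (rule linearI)
  show "second (x + y) = second x + second y" for x y
    by (simp add: second_def linear_add[OF linear_head] inner_add_left add_divide_distrib distrib_left)
  show "second (c *\<^sub>R x) = c *\<^sub>R second x" for c x
    by (simp add: second_def linear_scale[OF linear_head] algebra_simps add_divide_distrib)
qed

lemma sum_d2: "(\<Sum>i = 1..d - 2. (x \<bullet> e i) / 2 ^ i) = head x + (x \<bullet> e (d - 2)) / M"
proof -
  have "d - 2 = Suc (d - 3)"
    using d_ge by simp
  then show ?thesis
    by (simp add: head_def M_def)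
qed

lemma first_eq:
  "(\<Sum>i = 1..d - 2. (x \<bullet> e i) / 2 ^ i) + (x \<bullet> e (d - 1)) / (2 ^ (d - 1) - 1)
      + (x \<bullet> e d) / (2 ^ (d - 1) + 1 + alpha d) = first x"
  unfolding sum_d2 last_axis_bound by (simp add: first_def pow_d1 mult.commute)

lemma Delta_eq: "Delta d e = {x. (\<forall>i\<in>{1..d}. 0 \<le> x \<bullet> e i) \<and> first x \<le> 1}"
  unfolding Delta_def first_eq ..

text \<open>The candidate for the integer hull; \<open>integer_hull_Delta\<close> and
  \<open>truncation_eq_hull\<close> together confirm it.\<close>

definition truncation :: "(real ^ 'n) set" where
  "truncation = {x. (\<forall>i\<in>{1..d}. 0 \<le> x \<bullet> e i) \<and> first x \<le> 1 \<and> second x \<le> 1}"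

lemma truncation_subset_Delta: "truncation \<subseteq> Delta d e"
  by (auto simp: truncation_def Delta_eq)

lemma convex_Delta: "convex (Delta d e)"
proof -
  have "Delta d e = (\<Inter>i\<in>{1..d}. {x. 0 \<le> x \<bullet> e i}) \<inter> first -` {..1}"
    by (auto simp: Delta_eq)
  then show ?thesis
    by (simp add: convex_Int convex_INT convex_halfspace_ge inner_commute[of _ "e _"]
        convex_linear_vimage linear_first)
qed

lemma convex_truncation: "convex truncation"
proof -
  have "truncation = Delta d e \<inter> second -` {..1}"
    by (auto simp: Delta_eq truncation_def)
  then show ?thesis
    by (simp add: convex_Int convex_Delta convex_linear_vimage linear_second)
qed

lemma open_strict:
  "open {x. (\<forall>i\<in>{1..d}. 0 < x \<bullet> e i) \<and> first x < 1 \<and> second x < 1}"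
proof -
  have [continuous_intros]: "continuous_on UNIV first" "continuous_on UNIV second"
    using linear_first linear_second
    by (simp_all add: linear_continuous_on linear_conv_bounded_linear)
  have "{x. (\<forall>i\<in>{1..d}. 0 < x \<bullet> e i) \<and> first x < 1 \<and> second x < 1}
      = (\<Inter>i\<in>{1..d}. {x. 0 < x \<bullet> e i}) \<inter> ({x. first x < 1} \<inter> {x. second x < 1})"
    by auto
  also have "open \<dots>"
    by (intro open_Int open_INT ballI open_Collect_less continuous_intros) auto
  finally show ?thesis .
qed

lemma interior_truncation:
  assumes "\<And>i. i \<in> {1..d} \<Longrightarrow> 0 < x \<bullet> e i" "first x < 1" "second x < 1"
  shows "x \<in> interior truncation"
proof -
  have "{x. (\<forall>i\<in>{1..d}. 0 < x \<bullet> e i) \<and> first x < 1 \<and> second x < 1} \<subseteq> interior truncation"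
    by (intro interior_maximal open_strict) (force simp: truncation_def less_imp_le)
  then show ?thesis
    using assms by auto
qed

lemma head_e: "i \<in> {1..d} \<Longrightarrow> head (e i) = (if i \<le> d - 3 then 1 / 2 ^ i else 0)"
proof -
  assume i: "i \<in> {1..d}"
  have "head (e i) = (\<Sum>j = 1..d - 3. if i = j then 1 / 2 ^ j else 0)"
    unfolding head_def using i by (intro sum.cong) (auto simp: inner_e)
  then show ?thesis
    using i by auto
qed

lemma coordinate_cases:
  assumes "i \<in> {1..d}"
  obtains "i \<in> {1..d - 3}" | "i = d - 2" | "i = d - 1" | "i = d"
  using assms by (auto simp: atLeastAtMost_d)

lemma first_e_head: "i \<in> {1..d - 3} \<Longrightarrow> first (e i) = 1 / 2 ^ i"
  and second_e_head: "i \<in> {1..d - 3} \<Longrightarrow> second (e i) = 1 / 2 ^ i"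
  using d_ge by (auto simp: first_def second_def head_e inner_e)

lemma first_e_tail:
  "first (e (d - 2)) = 1 / M" "first (e (d - 1)) = 1 / (2 * M - 1)"
  "first (e d) = (M - 1) / (M * (2 * M - 1))"
  using d_ge by (auto simp: first_def head_e inner_e)

lemma second_e_tail:
  "second (e (d - 2)) = 2 / (2 * M + 1)" "second (e (d - 1)) = 1 / (2 * M + 1)"
  "second (e d) = 1 / (2 * M + 1)"
  using d_ge by (auto simp: second_def head_e inner_e)

lemma first_e_pos: "i \<in> {1..d} \<Longrightarrow> 0 < first (e i)"
  using M_ge by (elim coordinate_cases) (auto simp: first_e_head first_e_tail)

lemma second_e_pos: "i \<in> {1..d} \<Longrightarrow> 0 < second (e i)"
  using M_ge by (elim coordinate_cases) (auto simp: second_e_head second_e_tail)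

section \<open>The all-ones vector\<close>

definition ones :: "real ^ 'n" where "ones = (\<Sum>i = 1..d. e i)"

lemma inner_ones: "i \<in> {1..d} \<Longrightarrow> ones \<bullet> e i = 1"
proof -
  assume i: "i \<in> {1..d}"
  have "ones \<bullet> e i = (\<Sum>j = 1..d. if j = i then 1 else 0)"
    unfolding ones_def inner_sum_left using i by (intro sum.cong) (auto simp: inner_e)
  then show ?thesis
    using i by simp
qed

lemma head_ones: "head ones = 1 - 2 / M"
proof -
  have "head ones = (\<Sum>i = 1..d - 3. 1 / 2 ^ i)"
    unfolding head_def using d_ge by (intro sum.cong) (auto simp: inner_ones)
  then show ?thesis
    by (simp only: sum_inverse_powers pow_d3) simp
qed

text \<open>The geometric sum in \<open>head\<close> falls short of 1 by \<open>2 / M\<close>.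
  Coordinate \<open>d - 2\<close> supplies one half of this, and the last two coordinates together
  supply the other.\<close>

lemma first_ones: "first ones = 1"
proof -
  have "2 * M - 1 \<noteq> 0" "M \<noteq> 0"
    using M_ge by auto
  then have "1 / (2 * M - 1) + (M - 1) / (M * (2 * M - 1)) = 1 / M"
    by (simp add: divide_simps)
  then show ?thesis
    using d_ge by (simp add: first_def head_ones inner_ones)
qed

lemma second_ones: "second ones < 1"
proof -
  \<comment> \<open>The numerator is \<open>2 + 1 + 1\<close>, the tail of \<open>second\<close> at
    the all-ones vector, and \<open>2 / M\<close> is the gap left by \<open>head\<close>.\<close>
  have "4 / (2 * M + 1) < 2 / M"
    using M_ge by (simp add: field_simps)
  then show ?thesis
    using d_ge by (simp add: second_def head_ones inner_ones)
qed

lemma ones_int_lattice: "ones \<in> int_lattice"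
  by (simp add: int_lattice_iff inner_ones)

section \<open>Hollowness and lattice points\<close>

lemma first_expansion: "first x = (\<Sum>i = 1..d. (x \<bullet> e i) * first (e i))"
  by (subst e_expansion[symmetric])
    (simp add: linear_sum[OF linear_first] linear_scale[OF linear_first])

lemma hollow_Delta: "hollow (Delta d e)"
proof -
  have False if x: "x \<in> interior (Delta d e)" "x \<in> int_lattice" for x
  proof -
    \<comment> \<open>On the interior each coordinate is strictly positive, as a short step along
      \<open>- e i\<close> stays inside; integrality raises this to 1.\<close>
    have "1 \<le> x \<bullet> e i" if i: "i \<in> {1..d}" for i
    proof -
      have "- (x \<bullet> e i) < 0"
      proof (rule linear_less_of_interior[of "\<lambda>x. - (x \<bullet> e i)" "- e i"])
        show "linear (\<lambda>x. - (x \<bullet> e i))"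
          by (intro linearI) (auto simp: inner_add_left)
      qed (use i x in \<open>auto simp: Delta_eq inner_e\<close>)
      moreover obtain m where "x \<bullet> e i = of_int m"
        using x(2) i unfolding int_lattice_iff by (meson Ints_cases)
      ultimately show ?thesis
        by simp
    qed
    then have "(\<Sum>i = 1..d. (ones \<bullet> e i) * first (e i)) \<le> (\<Sum>i = 1..d. (x \<bullet> e i) * first (e i))"
      using first_e_pos by (intro sum_mono mult_right_mono) (auto simp: inner_ones less_imp_le)
    then have "1 \<le> first x"
      by (simp only: first_expansion[symmetric] first_ones)
    moreover have "first x < 1"
      using d_ge x by (intro linear_less_of_interior[OF linear_first first_e_pos[of d]])
        (auto simp: Delta_eq)
    ultimately show False by simp
  qed
  then show ?thesis
    by (auto simp: hollow_def)
qed

lemma second_scaled: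
  "(2 * M + 1) * second x
    = (2 * M + 1) * head x + (2 * (x \<bullet> e (d - 2)) + x \<bullet> e (d - 1) + x \<bullet> e d)"
proof -
  have "q * (h + t / q) = q * h + t" if "q \<noteq> 0" for q h t :: real
    using that by (simp add: distrib_left)
  then show ?thesis
    unfolding second_def using M_ge by auto
qed

text \<open>Already \<open>M / 2 = 2 ^ (d - 3)\<close> clears all denominators of
  \<open>head\<close>, so multiplying by \<open>M\<close> gives an even integer. This evenness
  drives the rounding in \<open>tail_integer_bound\<close>.\<close>

lemma head_int_lattice:
  assumes "x \<in> int_lattice"
  obtains m :: int where "M * head x = 2 * m"
proof -
  have "M / 2 * head x = (\<Sum>i = 1..d - 3. (x \<bullet> e i) * 2 ^ (d - 3 - i))"
    unfolding head_def sum_distrib_left pow_d3[symmetric]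
    by (intro sum.cong) (auto simp: power_diff power_add)
  also have "\<dots> \<in> \<int>"
    using assms by (intro Ints_sum Ints_mult Ints_power) (auto simp: int_lattice_iff)
  finally obtain m where "M / 2 * head x = of_int m"
    by (auto elim: Ints_cases)
  then show thesis
    by (intro that[of m]) simp
qed

lemma int_lattice_Delta_truncation:
  assumes "x \<in> Delta d e" "x \<in> int_lattice"
  shows "x \<in> truncation"
proof -
  obtain m where m: "M * head x = 2 * of_int m"
    using head_int_lattice[OF assms(2)] by (metis of_int_mult of_int_numeral)
  have "d - 2 \<in> {1..d}" "d - 1 \<in> {1..d}" "d \<in> {1..d}"
    using d_ge by auto
  then obtain y u v :: int where yuv: "x \<bullet> e (d - 2) = y" "x \<bullet> e (d - 1) = u" "x \<bullet> e d = v"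
    using assms(2) unfolding int_lattice_iff by (meson Ints_cases)
  have nonneg: "0 \<le> y" "0 \<le> u" "0 \<le> v"
    using assms(1) d_ge yuv[symmetric] by (auto simp: Delta_eq simp flip: of_int_0_le_iff[where ?'a = real])
  have "0 \<le> head x"
    using assms(1) by (auto simp: head_def Delta_eq intro!: sum_nonneg)
  then have "0 \<le> m"
    using m M_ge by (metis mult_nonneg_nonneg of_int_0_le_iff order_trans zero_le_mult_iff zero_le_numeral
        mult_less_cancel_right_disj not_le zero_less_numeral)
  define N :: int where "N = 2 ^ (d - 2)"
  have MN: "M = of_int N"
    by (simp add: N_def M_def)
  have N: "4 \<le> N"
    using M_ge by (simp add: MN)
  have head: "head x = 2 * m / M"
    using m M_ge by (simp add: field_simps)
  have "first x \<le> 1"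
    using assms(1) by (simp add: Delta_eq)
  \<comment> \<open>Clearing the denominators of \<open>first\<close> turns its inequality into the
    integer hypothesis of \<open>tail_integer_bound\<close>.\<close>
  then have "M * (2 * M - 1) * first x \<le> M * (2 * M - 1)"
    using M_ge by simp
  also have "M * (2 * M - 1) * first x =
      (2 * M - 1) * (2 * m) + ((2 * M - 1) * y + M * u + (M - 1) * v)"
    using M_ge by (simp add: first_def head yuv distrib_left)
  finally have "of_int ((2 * N - 1) * y + N * u + (N - 1) * v) \<le> (of_int ((2 * N - 1) * (N - 2 * m)) :: real)"
    by (simp add: MN algebra_simps)
  then have "N * (2 * y + u + v) \<le> (2 * N + 1) * (N - 2 * m)"
    using tail_integer_bound N nonneg \<open>0 \<le> m\<close> by (simp only: of_int_le_iff)
  then have "of_int (N * (2 * y + u + v)) \<le> (of_int ((2 * N + 1) * (N - 2 * m)) :: real)"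
    by (simp only: of_int_le_iff)
  then have "M * (2 * y + u + v) \<le> (2 * M + 1) * (M - 2 * m)"
    by (simp add: MN)
  \<comment> \<open>In the same way the rounded integer bound is the inequality for
    \<open>second\<close> with its denominators cleared.\<close>
  moreover have "M * (2 * M + 1) * second x = (2 * M + 1) * (2 * m) + M * (2 * y + u + v)"
  proof -
    have "(2 * M + 1) * second x = (2 * M + 1) * head x + (2 * y + u + v)"
      by (simp only: second_scaled yuv)
    then have "M * ((2 * M + 1) * second x) = (2 * M + 1) * (M * head x) + M * (2 * y + u + v)"
      by (simp only: distrib_left[of M] mult.left_commute[of M])
    then show ?thesis
      by (simp only: m mult.assoc)
  qed
  ultimately have "M * (2 * M + 1) * second x \<le> M * (2 * M + 1) * 1"
    by (simp add: algebra_simps)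
  then have "second x \<le> 1"
    using M_ge by (simp only: mult_le_cancel_left_pos mult_pos_pos)
  then show ?thesis
    using assms(1) by (simp add: truncation_def Delta_eq)
qed

section \<open>The lattice vertices\<close>

text \<open>The first three points span the bottom triangle of the prism; the last three satisfy
  \<open>second x = 1\<close> and span the top one.\<close>

definition base_vertices :: "(real ^ 'n) set" where
  "base_vertices = {0, M *\<^sub>R e (d - 2), (2 * M - 1) *\<^sub>R e (d - 1), (2 * M + 1) *\<^sub>R e d,
     e (d - 1) + (2 * M) *\<^sub>R e d, e (d - 2) + (2 * M - 1) *\<^sub>R e d}"

definition vertices :: "(real ^ 'n) set" where
  "vertices = base_vertices \<union> (\<lambda>i. 2 ^ i *\<^sub>R e i) ` {1..d - 3}"

lemma vertices_eq:
  "{0} \<union> (\<lambda>i. 2 ^ i *\<^sub>R e i) ` {1..d - 2}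
     \<union> {(2 ^ (d - 1) - 1) *\<^sub>R e (d - 1), (2 ^ (d - 1) + 1) *\<^sub>R e d,
        e (d - 1) + (2 ^ (d - 1)) *\<^sub>R e d, e (d - 2) + (2 ^ (d - 1) - 1) *\<^sub>R e d} = vertices"
proof -
  have "{1..d - 2} = insert (d - 2) {1..d - 3}"
    using d_ge by auto
  then show ?thesis
    unfolding vertices_def base_vertices_def pow_d1 M_def by auto
qed

lemma finite_vertices: "finite vertices"
  by (simp add: vertices_def base_vertices_def)

lemma power2_Ints: "(2::real) ^ i \<in> \<int>"
  by (intro Ints_power) simp

lemma vertices_int_lattice: "vertices \<subseteq> int_lattice"
proof -
  have "M \<in> \<int>"
    unfolding M_def by (rule power2_Ints)
  then show ?thesis
    using d_ge unfolding vertices_def base_vertices_def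
    by (auto simp: int_lattice_iff inner_e inner_add_left power2_Ints
        intro!: Ints_mult Ints_add Ints_diff)
qed

lemma vertices_truncation: "vertices \<subseteq> truncation"
proof -
  have M2: "2 * M - 1 > 0" "2 * M + 1 > 0" "M > 0"
    using M_ge by auto
  \<comment> \<open>The equations place the two top vertices off the axes on both oblique facets;
    the inequality is \<open>first x \<le> 1\<close> at the top vertex on the last axis.\<close>
  have "1 / (2 * M - 1) + 2 * M * ((M - 1) / (M * (2 * M - 1))) = 1"
    "1 / M + (2 * M - 1) * ((M - 1) / (M * (2 * M - 1))) = 1"
    "(2 * M + 1) * (M - 1) \<le> M * (2 * M - 1)"
    "1 / (2 * M + 1) + 2 * M * (1 / (2 * M + 1)) = 1"
    "2 / (2 * M + 1) + (2 * M - 1) * (1 / (2 * M + 1)) = 1"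
    using M2 by (simp_all add: divide_simps) (auto simp: algebra_simps)
  then show ?thesis
    using d_ge M2 M_ge unfolding vertices_def base_vertices_def
    by (auto simp: truncation_def inner_e inner_add_left first_e_tail second_e_tail first_e_head second_e_head
       linear_add[OF linear_first] linear_scale[OF linear_first] linear_0[OF linear_first]
       linear_add[OF linear_second] linear_scale[OF linear_second] linear_0[OF linear_second])
qed

section \<open>Vertices and maximality\<close>

text \<open>The weights \<open>(x \<bullet> e i) / 2 ^ i\<close> on the axis vertices add up to
  \<open>head x\<close>, so the head enters later combinations as a single summand of that
  weight.\<close>

lemma head_part_scaled:
  assumes "convex C" "C \<noteq> {}" "\<And>i. i \<in> {1..d} \<Longrightarrow> 0 \<le> x \<bullet> e i"
    "\<And>i. i \<in> {1..d - 3} \<Longrightarrow> 2 ^ i *\<^sub>R e i \<in> C"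
  shows "(\<Sum>i = 1..d - 3. (x \<bullet> e i) *\<^sub>R e i) \<in> (*\<^sub>R) (head x) ` C"
proof -
  have "(\<Sum>i = 1..d - 3. ((x \<bullet> e i) / 2 ^ i) *\<^sub>R 2 ^ i *\<^sub>R e i) \<in> (*\<^sub>R) (head x) ` C"
    unfolding head_def using assms by (intro scaleR_image_sum) auto
  then show ?thesis
    by simp
qed

lemma head_nonneg: "(\<And>i. i \<in> {1..d} \<Longrightarrow> 0 \<le> x \<bullet> e i) \<Longrightarrow> 0 \<le> head x"
  by (auto simp: head_def intro!: sum_nonneg)

text \<open>Coordinates divided by the axis lengths are barycentric weights, and the slack
  \<open>1 - first x\<close> is the weight of the origin.\<close>

lemma Delta_hull:
  "Delta d e = convex hull ({0} \<union> (\<lambda>i. 2 ^ i *\<^sub>R e i) ` {1..d - 2}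
     \<union> {(2 ^ (d - 1) - 1) *\<^sub>R e (d - 1), (2 ^ (d - 1) + 1 + alpha d) *\<^sub>R e d})"
  (is "_ = convex hull ?V")
proof
  have "{1..d - 2} = insert (d - 2) {1..d - 3}"
    using d_ge by auto
  then have image: "(\<lambda>i. 2 ^ i *\<^sub>R e i) ` {1..d - 2}
      = insert (M *\<^sub>R e (d - 2)) ((\<lambda>i. 2 ^ i *\<^sub>R e i) ` {1..d - 3})"
    by (simp add: M_def)
  have V: "?V = {0, M *\<^sub>R e (d - 2), (2 * M - 1) *\<^sub>R e (d - 1), (M * (2 * M - 1) / (M - 1)) *\<^sub>R e d}
      \<union> (\<lambda>i. 2 ^ i *\<^sub>R e i) ` {1..d - 3}"
    unfolding last_axis_bound image unfolding pow_d1 by blast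
  have "2 * M - 1 > 0" "M > 0" "M - 1 > 0"
    using M_ge by auto
  then show "convex hull ?V \<subseteq> Delta d e"
    using d_ge unfolding V
    by (intro hull_minimal convex_Delta)
      (auto simp: Delta_eq inner_e first_e_tail first_e_head
        linear_scale[OF linear_first] linear_0[OF linear_first])
  show "Delta d e \<subseteq> convex hull ?V"
  proof
    fix x assume "x \<in> Delta d e"
    then have nonneg: "\<And>i. i \<in> {1..d} \<Longrightarrow> 0 \<le> x \<bullet> e i" and le: "first x \<le> 1"
      by (auto simp: Delta_eq)
    let ?C = "convex hull ?V"
    let ?a = "(x \<bullet> e (d - 2)) / M" and ?b = "(x \<bullet> e (d - 1)) / (2 * M - 1)"
      and ?c = "(M - 1) * (x \<bullet> e d) / (M * (2 * M - 1))"
    have pos: "0 \<le> ?a" "0 \<le> ?b" "0 \<le> ?c" "0 \<le> head x"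
      using nonneg d_ge M_ge head_nonneg by auto
    have mem: "M *\<^sub>R e (d - 2) \<in> ?C" "(2 * M - 1) *\<^sub>R e (d - 1) \<in> ?C"
      "(M * (2 * M - 1) / (M - 1)) *\<^sub>R e d \<in> ?C" "0 \<in> ?C"
      "\<And>i. i \<in> {1..d - 3} \<Longrightarrow> 2 ^ i *\<^sub>R e i \<in> ?C"
      unfolding V by (auto intro!: hull_inc)
    have "(\<Sum>i = 1..d - 3. (x \<bullet> e i) *\<^sub>R e i) \<in> (*\<^sub>R) (head x) ` ?C"
      using mem nonneg by (intro head_part_scaled) auto
    then have "(\<Sum>i = 1..d - 3. (x \<bullet> e i) *\<^sub>R e i) + ?a *\<^sub>R M *\<^sub>R e (d - 2) + ?b *\<^sub>R (2 * M - 1) *\<^sub>R e (d - 1)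
        + ?c *\<^sub>R (M * (2 * M - 1) / (M - 1)) *\<^sub>R e d + (1 - first x) *\<^sub>R 0
      \<in> (*\<^sub>R) (head x + ?a + ?b + ?c + (1 - first x)) ` ?C"
      using pos le mem by (intro scaleR_image_add convex_convex_hull imageI) auto
    also have "head x + ?a + ?b + ?c + (1 - first x) = 1"
      by (simp add: first_def)
    also have "(\<Sum>i = 1..d - 3. (x \<bullet> e i) *\<^sub>R e i) + ?a *\<^sub>R M *\<^sub>R e (d - 2) + ?b *\<^sub>R (2 * M - 1) *\<^sub>R e (d - 1)
        + ?c *\<^sub>R (M * (2 * M - 1) / (M - 1)) *\<^sub>R e d + (1 - first x) *\<^sub>R 0
      = (\<Sum>i = 1..d. (x \<bullet> e i) *\<^sub>R e i)"
      using M_ge unfolding sum_d by simp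
    finally show "x \<in> ?C"
      by (simp add: e_expansion)
  qed
qed

text \<open>The lines through corresponding vertices of the two triangles of the prism meet in the last
  vertex of \<^const>\<open>Delta\<close>. Along each line, replace the weight \<open>c\<close> of the bottom vertex (among the
  barycentric coordinates with respect to the simplex) by the mixture with ratio \<open>\<theta>\<close> of the
  bottom and top vertex; a common \<open>\<theta>\<close> makes the weight \<open>\<mu>\<close> of the last vertex vanish.\<close>

lemma truncation_subset_hull: "truncation \<subseteq> convex hull vertices"
proof
  fix x assume "x \<in> truncation"
  then have nonneg: "\<And>i. i \<in> {1..d} \<Longrightarrow> 0 \<le> x \<bullet> e i" and le: "first x \<le> 1" "second x \<le> 1"
    by (auto simp: truncation_def)
  define C where "C = convex hull vertices"
  define y u v where "y = x \<bullet> e (d - 2)" and "u = x \<bullet> e (d - 1)" and "v = x \<bullet> e d"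
  define c1 c2 \<mu> where "c1 = y / M" and "c2 = u / (2 * M - 1)"
    and "\<mu> = (M - 1) * v / (M * (2 * M - 1))"
  define c0 where "c0 = 1 - head x - c1 - c2 - \<mu>"
  \<comment> \<open>The coefficients compare how much weight of the last vertex each exchange
    absorbs: with \<open>\<theta> = 1\<close> the three exchanges together absorb
    \<open>(M - 1) * T\<close>.\<close>
  define T where "T = (2 * M + 1) * c0 + c1 + 2 * c2"
  define \<theta> where "\<theta> = \<mu> / ((M - 1) * T)"
  have Mpos: "0 < M" "0 < M - 1" "0 < 2 * M - 1" "0 < 2 * M + 1"
    using M_ge by auto
  have yuv: "y = M * c1" "u = (2 * M - 1) * c2" "(M - 1) * v = M * (2 * M - 1) * \<mu>"
    using Mpos by (auto simp: c1_def c2_def \<mu>_def)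
  have "0 \<le> y" "0 \<le> u" "0 \<le> v"
    using nonneg d_ge by (simp_all add: y_def u_def v_def)
  moreover have "c0 = 1 - first x"
    by (simp add: c0_def c1_def c2_def \<mu>_def y_def u_def v_def first_def)
  ultimately have c: "0 \<le> c0" "0 \<le> c1" "0 \<le> c2" "0 \<le> \<mu>" "0 \<le> head x"
    using nonneg Mpos le head_nonneg by (simp_all add: c1_def c2_def \<mu>_def)
  have "0 \<le> T"
    using c Mpos by (simp add: T_def)
  have "(2 * M + 1) * second x = (2 * M + 1) * head x + (2 * y + u + v)"
    by (simp only: second_scaled y_def u_def v_def)
  then have "(2 * M + 1) * head x + (2 * y + u + v) \<le> (2 * M + 1) * 1"
    using le Mpos by (metis mult_le_cancel_left_pos)
  then have "(M - 1) * ((2 * M + 1) * head x + (2 * y + u + v)) \<le> (M - 1) * (2 * M + 1)"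
    using Mpos by simp
  then have "(M - 1) * (2 * M + 1) * head x + (M - 1) * (2 * y + u) + M * (2 * M - 1) * \<mu>
      \<le> (M - 1) * (2 * M + 1)"
    unfolding yuv(3)[symmetric] by (simp add: algebra_simps)
  moreover have "head x = 1 - c0 - c1 - c2 - \<mu>"
    by (simp add: c0_def)
  \<comment> \<open>After eliminating \<open>head x\<close>, this is the inequality
    \<open>second x \<le> 1\<close>.\<close>
  ultimately have "\<mu> \<le> (M - 1) * T"
    unfolding yuv(1,2) T_def by (simp add: algebra_simps)
  \<comment> \<open>If \<open>T = 0\<close> then \<open>\<mu> = 0\<close>, and division by zero
    yields the suitable value \<open>\<theta> = 0\<close>.\<close>
  then have \<theta>: "\<theta> * ((M - 1) * T) = \<mu>" "0 \<le> \<theta>" "\<theta> \<le> 1"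
    using c \<open>0 \<le> T\<close> Mpos by (auto simp: \<theta>_def divide_le_eq_1)
  have v_eq: "v = \<theta> * (M * (2 * M - 1)) * T"
  proof -
    have "(M - 1) * v = (M - 1) * (\<theta> * (M * (2 * M - 1)) * T)"
      unfolding yuv(3) \<theta>(1)[symmetric] by simp
    then show ?thesis
      using Mpos by simp
  qed
  have mem: "M *\<^sub>R e (d - 2) \<in> C" "(2 * M - 1) *\<^sub>R e (d - 1) \<in> C" "(2 * M + 1) *\<^sub>R e d \<in> C" "0 \<in> C"
    "e (d - 1) + (2 * M) *\<^sub>R e d \<in> C" "e (d - 2) + (2 * M - 1) *\<^sub>R e d \<in> C"
    "\<And>i. i \<in> {1..d - 3} \<Longrightarrow> 2 ^ i *\<^sub>R e i \<in> C"
    unfolding C_def vertices_def base_vertices_def by (auto intro!: hull_inc)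
  have [simp]: "convex C"
    by (simp add: C_def)
  \<comment> \<open>The factors of the top weights come from collinearity. For instance,
    \<open>M\<close> times the top vertex \<open>e (d - 2) + (2 * M - 1) *\<^sub>R e d\<close> is
    the bottom vertex \<open>M *\<^sub>R e (d - 2)\<close> plus \<open>M - 1\<close> times the last
    vertex of \<open>Delta\<close>.\<close>
  let ?a0 = "(1 - \<theta>) * c0" and ?a1 = "(1 - \<theta>) * c1" and ?a2 = "(1 - \<theta>) * c2"
    and ?b0 = "\<theta> * (M * (2 * M - 1)) * c0" and ?b1 = "\<theta> * M * c1" and ?b2 = "\<theta> * (2 * M - 1) * c2"
  have pos: "0 \<le> ?a0" "0 \<le> ?a1" "0 \<le> ?a2" "0 \<le> ?b0" "0 \<le> ?b1" "0 \<le> ?b2"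
    using c \<theta> Mpos by auto
  have combine: "s + a0 *\<^sub>R 0 + a1 *\<^sub>R m1 *\<^sub>R p + a2 *\<^sub>R m2 *\<^sub>R q + b0 *\<^sub>R m3 *\<^sub>R r
      + b1 *\<^sub>R (p + m4 *\<^sub>R r) + b2 *\<^sub>R (q + m5 *\<^sub>R r)
    = s + (a1 * m1 + b1) *\<^sub>R p + (a2 * m2 + b2) *\<^sub>R q + (b0 * m3 + b1 * m4 + b2 * m5) *\<^sub>R r"
    for s p q r :: "real ^ 'n" and a0 a1 a2 b0 b1 b2 m1 m2 m3 m4 m5 :: real
    by (simp add: scaleR_add_left scaleR_add_right)
  have "(\<Sum>i = 1..d - 3. (x \<bullet> e i) *\<^sub>R e i) \<in> (*\<^sub>R) (head x) ` C"
    using mem nonneg by (intro head_part_scaled) auto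
  then have "(\<Sum>i = 1..d - 3. (x \<bullet> e i) *\<^sub>R e i) + ?a0 *\<^sub>R 0 + ?a1 *\<^sub>R M *\<^sub>R e (d - 2)
      + ?a2 *\<^sub>R (2 * M - 1) *\<^sub>R e (d - 1) + ?b0 *\<^sub>R (2 * M + 1) *\<^sub>R e d
      + ?b1 *\<^sub>R (e (d - 2) + (2 * M - 1) *\<^sub>R e d) + ?b2 *\<^sub>R (e (d - 1) + (2 * M) *\<^sub>R e d)
    \<in> (*\<^sub>R) (head x + ?a0 + ?a1 + ?a2 + ?b0 + ?b1 + ?b2) ` C" (is "?lhs \<in> _")
    using pos c mem by (intro scaleR_image_add imageI) auto
  also have "head x + ?a0 + ?a1 + ?a2 + ?b0 + ?b1 + ?b2 = head x + c0 + c1 + c2 + \<theta> * ((M - 1) * T)"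
    by (simp add: T_def algebra_simps)
  also have "\<dots> = 1"
    unfolding \<theta>(1) by (simp add: c0_def)
  also have "?lhs = (\<Sum>i = 1..d - 3. (x \<bullet> e i) *\<^sub>R e i) + (?a1 * M + ?b1) *\<^sub>R e (d - 2)
      + (?a2 * (2 * M - 1) + ?b2) *\<^sub>R e (d - 1)
      + (?b0 * (2 * M + 1) + ?b1 * (2 * M - 1) + ?b2 * (2 * M)) *\<^sub>R e d"
    by (rule combine)
  also have "?a1 * M + ?b1 = y"
    by (simp add: yuv algebra_simps)
  also have "?a2 * (2 * M - 1) + ?b2 = u"
    by (simp add: yuv algebra_simps)
  also have "?b0 * (2 * M + 1) + ?b1 * (2 * M - 1) + ?b2 * (2 * M) = v"
    by (simp add: v_eq T_def algebra_simps)
  finally have "(\<Sum>i = 1..d. (x \<bullet> e i) *\<^sub>R e i) \<in> (*\<^sub>R) 1 ` C"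
    unfolding sum_d y_def u_def v_def .
  then show "x \<in> convex hull vertices"
    by (simp add: e_expansion C_def)
qed

text \<open>Three inclusions close a cycle: from \<open>truncation\<close> to the hull of
  \<open>vertices\<close>, from there to the integer hull, and back to \<open>truncation\<close> by
  rounding.\<close>

lemma integer_hull_Delta: "integer_hull (Delta d e) = convex hull vertices"
  and truncation_eq_hull: "truncation = convex hull vertices"
proof -
  have hull: "convex hull vertices \<subseteq> integer_hull (Delta d e)"
    unfolding integer_hull_def using vertices_int_lattice vertices_truncation truncation_subset_Delta
    by (intro hull_mono) auto
  have "integer_hull (Delta d e) \<subseteq> truncation"
    unfolding integer_hull_def
    by (intro hull_minimal convex_truncation) (auto intro: int_lattice_Delta_truncation)
  then show "integer_hull (Delta d e) = convex hull vertices" "truncation = convex hull vertices"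
    using hull truncation_subset_hull by auto
qed

text \<open>Every inequality of \<open>truncation\<close> that is tight at \<open>z\<close> is
  violated by \<open>p\<close>. The ray from \<open>p\<close> through \<open>z\<close> therefore
  enters the interior of \<open>truncation\<close> just beyond \<open>z\<close>, and
  \<open>z\<close> lies strictly between a point of \<open>P\<close> and an interior point of
  \<open>P\<close>.\<close>

lemma lattice_point_interior:
  assumes P: "convex P" "truncation \<subseteq> P" "p \<in> P"
    and coord: "\<And>i. i \<in> {1..d} \<Longrightarrow> 0 < z \<bullet> e i \<or> z \<bullet> e i = 0 \<and> p \<bullet> e i < 0"
    and first: "first z < 1 \<or> first z = 1 \<and> 1 < first p" and second: "second z < 1"
  shows "z \<in> interior P"
proof -
  have "\<forall>\<^sub>F t in at_right 0. \<forall>i\<in>{1..d}. 0 < z \<bullet> e i + t * (z \<bullet> e i - p \<bullet> e i)"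
    using coord by (intro eventually_ball_finite ballI eventually_perturbation_pos) fastforce+
  moreover have "\<forall>\<^sub>F t in at_right 0. 0 < (1 - first z) + t * (first p - first z)"
    using first by (intro eventually_perturbation_pos) auto
  moreover have "\<forall>\<^sub>F t in at_right 0. 0 < (1 - second z) + t * (second p - second z)"
    using second by (intro eventually_perturbation_pos) auto
  moreover have "\<forall>\<^sub>F t in at_right 0. 0 < (t::real)"
    by (rule eventually_at_right_less)
  ultimately have "\<forall>\<^sub>F t in at_right 0. 0 < t \<and> z + t *\<^sub>R (z - p) \<in> interior truncation"
  proof eventually_elim
    case (elim t)
    then show ?case
      by (auto intro!: interior_truncation simp: inner_add_left inner_diff_left algebra_simps
        linear_add[OF linear_first] linear_scale[OF linear_first] linear_diff[OF linear_first]
        linear_add[OF linear_second] linear_scale[OF linear_second] linear_diff[OF linear_second])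
  qed
  then obtain t where t: "0 < t" "z + t *\<^sub>R (z - p) \<in> interior truncation"
    using eventually_happens'[OF trivial_limit_at_right_real] by blast
  \<comment> \<open>Shrinking towards \<open>p\<close> by the factor \<open>1 / (1 + t)\<close>
    takes the point beyond \<open>z\<close> back to \<open>z\<close>.\<close>
  have "p - (1 / (1 + t)) *\<^sub>R (p - (z + t *\<^sub>R (z - p))) \<in> interior P"
    using t interior_mono[OF P(2)] P
    by (intro mem_interior_convex_shrink) auto
  moreover have "p - (z + t *\<^sub>R (z - p)) = (1 + t) *\<^sub>R (p - z)"
    by (simp add: algebra_simps)
  ultimately show ?thesis
    using t by simp
qed

lemma truncation_maximal:
  assumes P: "lattice_polytope P" "hollow P" "truncation \<subseteq> P"
  shows "P = truncation"
proof (rule ccontr)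
  assume "P \<noteq> truncation"
  obtain S where S: "S \<subseteq> int_lattice" "P = convex hull S"
    using P by (auto simp: lattice_polytope_def)
  then have "convex P"
    by simp
  have "\<not> S \<subseteq> truncation"
    using S P \<open>P \<noteq> truncation\<close> hull_minimal[of S truncation] convex_truncation by auto
  then obtain p where p: "p \<in> S" "p \<notin> truncation"
    by blast
  then have "p \<in> P" "p \<in> int_lattice"
    using S by (auto intro: hull_inc)
  \<comment> \<open>A lattice point cannot violate the truncating inequality alone, so
    \<open>p\<close> violates one whose facet carries a suitable lattice point.\<close>
  then have "p \<notin> Delta d e"
    using int_lattice_Delta_truncation p(2) by blast
  then consider j where "j \<in> {1..d}" "p \<bullet> e j < 0" | "1 < first p"
    by (force simp: Delta_eq)
  then show False
  proof cases
    case 1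
    \<comment> \<open>Only coordinate \<open>j\<close> vanishes here, and the positive coefficients
      of \<open>first\<close> make the oblique inequality strict.\<close>
    have "ones - e j \<in> interior P"
      using \<open>convex P\<close> P(3) \<open>p \<in> P\<close> 1 first_e_pos[OF 1(1)] second_e_pos[OF 1(1)] second_ones
      by (intro lattice_point_interior[of P p])
        (auto simp: inner_diff_left inner_ones inner_e first_ones
          linear_diff[OF linear_first] linear_diff[OF linear_second])
    moreover have "ones - e j \<in> int_lattice"
      using 1 by (auto simp: int_lattice_iff inner_diff_left inner_ones inner_e)
    ultimately show False
      using P(2) by (auto simp: hollow_def)
  next
    case 2
    have "ones \<in> interior P"
      using \<open>convex P\<close> P(3) \<open>p \<in> P\<close> 2 second_ones
      by (intro lattice_point_interior[of P p]) (auto simp: inner_ones first_ones)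
    then show False
      using P(2) ones_int_lattice by (auto simp: hollow_def)
  qed
qed

section \<open>Dimension and strict inclusion\<close>

lemma interior_truncation_nonempty: "interior truncation \<noteq> {}"
proof -
  have "(1 / 2) *\<^sub>R ones \<in> interior truncation"
    using second_ones by (intro interior_truncation)
      (auto simp: inner_ones linear_scale[OF linear_first] linear_scale[OF linear_second] first_ones)
  then show ?thesis by blast
qed

lemma aff_dim_truncation: "aff_dim truncation = int d"
proof -
  have "DIM(real ^ 'n) = d"
    using bij_betw_same_card[OF e_bij] by simp
  then show ?thesis
    using aff_dim_nonempty_interior[OF interior_truncation_nonempty] by simp
qed

lemma truncation_psubset_Delta: "truncation \<subset> Delta d e"
proof -
  \<comment> \<open>The last vertex of \<open>Delta\<close> is cut off by the truncating
    inequality.\<close>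
  let ?x = "(M * (2 * M - 1) / (M - 1)) *\<^sub>R e d"
  have "2 * M - 1 > 0" "M > 0" "M - 1 > 0" "d \<in> {1..d}" "(M - 1) * (2 * M + 1) < M * (2 * M - 1)"
    using M_ge d_ge by (auto simp: algebra_simps)
  then have "?x \<in> Delta d e" "1 < second ?x"
    by (auto simp: Delta_eq inner_e first_e_tail second_e_tail linear_scale[OF linear_first]
        linear_scale[OF linear_second])
  then show ?thesis
    using truncation_subset_Delta by (force simp: truncation_def)
qed

lemma convex_body_Delta: "convex_body (Delta d e)"
proof -
  have "compact (Delta d e)"
    unfolding Delta_hull by (intro finite_imp_compact_convex_hull) auto
  moreover have "interior (Delta d e) \<noteq> {}"
    using interior_truncation_nonempty interior_mono[OF truncation_subset_Delta] by auto
  ultimately show ?thesis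
    by (simp add: convex_body_def convex_Delta)
qed

section \<open>The prism and the pyramid\<close>

text \<open>The weights of the homogeneous vertex coordinates in \<open>denom\<close> are chosen so that top minus
  bottom is the same homogeneous vector over every vertex of the triangle, namely the last vertex of
  \<^const>\<open>Delta\<close>, where the images of the parallel edges meet (everything scaled by \<open>M - 1\<close>).\<close>

definition numer :: "(real \<times> real) \<times> real \<Rightarrow> real ^ 'n" where
  "numer = (\<lambda>((p, q), r). (M * p) *\<^sub>R e (d - 2) + ((M - 1 / 2) * q) *\<^sub>R e (d - 1)
     + (M * (2 * M - 1) * r) *\<^sub>R e d)"

definition denom :: "(real \<times> real) \<times> real \<Rightarrow> real" where
  "denom = (\<lambda>((p, q), r). (1 - p - q) / (2 * M + 1) + p + q / 2 + (M - 1) * r)"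

definition prism_map :: "(real \<times> real) \<times> real \<Rightarrow> real ^ 'n" where
  "prism_map x = numer x /\<^sub>R denom x"

lemma numer_affine: "numer ((1 - t) *\<^sub>R a + t *\<^sub>R b) = (1 - t) *\<^sub>R numer a + t *\<^sub>R numer b"
  by (cases a; cases "fst a"; cases b; cases "fst b")
    (simp add: numer_def algebra_simps add_divide_distrib diff_divide_distrib)

lemma denom_affine: "denom ((1 - t) *\<^sub>R a + t *\<^sub>R b) = (1 - t) * denom a + t * denom b"
proof -
  obtain p q r p' q' r' where ab: "a = ((p, q), r)" "b = ((p', q'), r')"
    by (metis prod.exhaust)
  have "1 - ((1 - t) * p + t * p') - ((1 - t) * q + t * q') = (1 - t) * (1 - p - q) + t * (1 - p' - q')"
    by (simp add: algebra_simps)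
  then show ?thesis
    by (simp add: ab denom_def add_divide_distrib distrib_left)
qed

abbreviation prism_vertices :: "((real \<times> real) \<times> real) set" where
  "prism_vertices \<equiv> {(0, 0), (1, 0), (0, 1)} \<times> {0, 1}"

lemma standard_prism: "(convex hull {(0, 0), (1, 0), (0, 1)}) \<times> {0..1} = convex hull prism_vertices"
proof -
  have "convex hull {0, 1} = {0..1::real}"
    by (simp add: closed_segment_eq_real_ivl flip: segment_convex_hull)
  then show ?thesis
    by (simp only: convex_hull_Times)
qed

text \<open>\<open>denom\<close> is affine, so its positivity set is convex, and the six vertices
  suffice.\<close>

lemma denom_pos: "x \<in> convex hull prism_vertices \<Longrightarrow> 0 < denom x"
proof -
  have "convex {x. 0 < denom x}"
    unfolding convex_alt
  proof (intro ballI allI impI, elim conjE)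
    fix x y and t :: real
    assume "x \<in> {x. 0 < denom x}" "y \<in> {x. 0 < denom x}" "0 \<le> t" "t \<le> 1"
    then show "(1 - t) *\<^sub>R x + t *\<^sub>R y \<in> {x. 0 < denom x}"
      by (cases "t = 1") (auto simp: denom_affine intro: add_pos_nonneg)
  qed
  then have "convex hull prism_vertices \<subseteq> {x. 0 < denom x}"
    using M_ge by (intro hull_minimal) (auto simp: denom_def add_pos_pos)
  then show "x \<in> convex hull prism_vertices \<Longrightarrow> 0 < denom x"
    by blast
qed

lemma prism_map_segment:
  assumes "a \<in> convex hull prism_vertices" "b \<in> convex hull prism_vertices"
  shows "prism_map ` closed_segment a b = closed_segment (prism_map a) (prism_map b)"
  unfolding prism_map_def using assms
  by (intro projective_image_closed_segment numer_affine denom_affine denom_pos)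

lemma numer_inner:
  "numer ((p, q), r) \<bullet> e (d - 2) = M * p"
  "numer ((p, q), r) \<bullet> e (d - 1) = (M - 1 / 2) * q"
  "numer ((p, q), r) \<bullet> e d = M * (2 * M - 1) * r"
  using d_ge by (auto simp: numer_def inner_add_left inner_e)

text \<open>Equal images have proportional numerators, and \<open>numer\<close> is linear and
  injective, so the arguments differ by a factor \<open>k\<close>. The denominators have the same
  ratio, but \<open>denom\<close> has the nonzero constant term \<open>1 / (2 * M + 1)\<close>,
  which forces \<open>k = 1\<close>.\<close>

lemma inj_on_prism_map: "inj_on prism_map (convex hull prism_vertices)"
proof (rule inj_onI)
  fix a b assume *: "a \<in> convex hull prism_vertices" "b \<in> convex hull prism_vertices"
    and eq: "prism_map a = prism_map b"
  obtain p q r p' q' r' where ab: "a = ((p, q), r)" "b = ((p', q'), r')"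
    by (metis prod.exhaust)
  have pos: "0 < denom a" "0 < denom b"
    using * by (auto intro: denom_pos)
  define k where "k = denom a / denom b"
  have "numer a = denom a *\<^sub>R prism_map a" "numer b = denom b *\<^sub>R prism_map b"
    using pos by (simp_all add: prism_map_def)
  then have numer: "numer a = k *\<^sub>R numer b"
    using pos eq by (simp add: k_def)
  have M: "M \<noteq> 0" "2 * M - 1 \<noteq> 0" "M - 1 / 2 \<noteq> 0" "2 * M + 1 > 0"
    using M_ge by auto
  have "M * p = M * (k * p')" "(M - 1 / 2) * q = (M - 1 / 2) * (k * q')"
      "(M * (2 * M - 1)) * r = (M * (2 * M - 1)) * (k * r')"
    using arg_cong[OF numer, of "\<lambda>x. x \<bullet> e (d - 2)"] arg_cong[OF numer, of "\<lambda>x. x \<bullet> e (d - 1)"]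
      arg_cong[OF numer, of "\<lambda>x. x \<bullet> e d"]
    by (simp_all only: ab numer_inner inner_scaleR_left mult.left_commute[of k])
  then have pqr: "p = k * p'" "q = k * q'" "r = k * r'"
    using M by simp_all
  have "denom a = k * denom b"
    using pos by (simp add: k_def)
  moreover have "denom a - 1 / (2 * M + 1) = k * (denom b - 1 / (2 * M + 1))"
    unfolding ab denom_def pqr by (simp add: algebra_simps add_divide_distrib diff_divide_distrib)
  ultimately have "k * (1 / (2 * M + 1)) = 1 / (2 * M + 1)"
    by (simp add: right_diff_distrib)
  then have "k = 1"
    using M by simp
  then show "a = b"
    using pqr ab by simp
qed

lemma prism_map_vertices: "prism_map ` prism_vertices = base_vertices"
proof -
  have M: "M \<noteq> 0" "2 * M - 1 \<noteq> 0" "2 * M + 1 \<noteq> 0" "M - 1 \<noteq> 0"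
    using M_ge by auto
  have "prism_map ((0, 0), 0) = 0" "prism_map ((1, 0), 0) = M *\<^sub>R e (d - 2)"
    by (simp_all add: prism_map_def numer_def denom_def)
  moreover have "prism_map ((0, 1), 0) = (2 * M - 1) *\<^sub>R e (d - 1)"
    by (simp add: prism_map_def numer_def denom_def right_diff_distrib)
  moreover have "prism_map ((0, 0), 1) = (2 * M + 1) *\<^sub>R e d"
  proof -
    have "denom ((0, 0), 1) = M * (2 * M - 1) / (2 * M + 1)"
      using M by (simp add: denom_def field_simps)
    then show ?thesis
      using M by (simp add: prism_map_def numer_def)
  qed
  moreover have "prism_map ((1, 0), 1) = e (d - 2) + (2 * M - 1) *\<^sub>R e d"
    using M by (simp add: prism_map_def numer_def denom_def scaleR_add_right)
  moreover have "prism_map ((0, 1), 1) = e (d - 1) + (2 * M) *\<^sub>R e d"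
  proof -
    have "denom ((0, 1), 1) = M - 1 / 2"
      by (simp add: denom_def)
    moreover have "numer ((0, 1), 1) = (M - 1 / 2) *\<^sub>R (e (d - 1) + (2 * M) *\<^sub>R e d)"
      by (simp add: numer_def algebra_simps)
    moreover have "M - 1 / 2 \<noteq> 0"
      using M by simp
    ultimately show ?thesis
      by (simp add: prism_map_def)
  qed
  moreover have "prism_vertices = {((0, 0), 0), ((1, 0), 0), ((0, 1), 0), ((0, 0), 1), ((1, 0), 1), ((0, 1), 1)}"
    by auto
  ultimately show ?thesis
    unfolding base_vertices_def by auto
qed

lemma triangular_prism_base: "triangular_prism (convex hull base_vertices)"
proof -
  have "prism_map ` (convex hull prism_vertices) = convex hull base_vertices"
    using convex_hull_image_closed_segment[OF prism_map_segment] prism_map_vertices by simp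
  then have "combinatorially_equivalent (convex hull base_vertices) (convex hull prism_vertices)"
    using combinatorially_equivalent_image[OF convex_convex_hull inj_on_prism_map prism_map_segment]
    by simp
  moreover have "polytope (convex hull base_vertices)"
    by (intro polytope_convex_hull) (simp add: base_vertices_def)
  ultimately show ?thesis
    by (simp add: triangular_prism_def standard_prism)
qed

text \<open>Apexes are added in the order of the axes: all earlier points lie in the hyperplane
  where coordinate \<open>Suc k\<close> vanishes, and the new apex does not.\<close>

lemma iterated_pyramid_hull:
  "k \<le> d - 3 \<Longrightarrow> iterated_pyramid k (convex hull base_vertices)
     (convex hull (base_vertices \<union> (\<lambda>i. 2 ^ i *\<^sub>R e i) ` {1..k}))"
proof (induction k)
  case 0
  then show ?case
    by (simp add: iterated_pyramid.base)
next
  case (Suc k)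
  let ?P = "convex hull (base_vertices \<union> (\<lambda>i. 2 ^ i *\<^sub>R e i) ` {1..k})"
  let ?a = "2 ^ Suc k *\<^sub>R e (Suc k)"
  have k: "Suc k \<in> {1..d}"
    using Suc.prems by auto
  have "affine hull ?P \<subseteq> {x. e (Suc k) \<bullet> x = 0}"
    unfolding affine_hull_convex_hull using Suc.prems d_ge
    by (intro hull_minimal affine_hyperplane) (auto simp: base_vertices_def inner_e inner_add_right)
  then have "?a \<notin> affine hull ?P"
    using k by (auto simp: inner_e)
  then have "iterated_pyramid (Suc k) (convex hull base_vertices) (convex hull (insert ?a ?P))"
    using Suc by (intro iterated_pyramid.apex) auto
  also have "convex hull (insert ?a ?P)
      = convex hull (insert ?a (base_vertices \<union> (\<lambda>i. 2 ^ i *\<^sub>R e i) ` {1..k}))"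
    by (simp add: hull_insert[symmetric])
  also have "insert ?a (base_vertices \<union> (\<lambda>i. 2 ^ i *\<^sub>R e i) ` {1..k})
      = base_vertices \<union> (\<lambda>i. 2 ^ i *\<^sub>R e i) ` {1..Suc k}"
    by (simp add: atLeastAtMostSuc_conv)
  finally show ?case .
qed

end

theorem theorem3p2:
  fixes d :: nat and e :: "nat \<Rightarrow> real ^ 'n"
  assumes "d \<ge> 4" and "CARD('n) = d"
    and "bij_betw e {1..d} Basis"
  shows
    "Delta d e = convex hull
       ({0} \<union> (\<lambda>i. (2 ^ i) *\<^sub>R e i) ` {1..d - 2}
        \<union> {(2 ^ (d - 1) - 1) *\<^sub>R e (d - 1), (2 ^ (d - 1) + 1 + alpha d) *\<^sub>R e d})
     \<and> integer_hull (Delta d e) =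
        {x. (\<forall>i\<in>{1..d}. 0 \<le> x \<bullet> e i) \<and>
          (\<Sum>i = 1..d - 2. (x \<bullet> e i) / 2 ^ i) + (x \<bullet> e (d - 1)) / (2 ^ (d - 1) - 1)
            + (x \<bullet> e d) / (2 ^ (d - 1) + 1 + alpha d) \<le> 1 \<and>
          (\<Sum>i = 1..d - 3. (x \<bullet> e i) / 2 ^ i)
            + (2 * (x \<bullet> e (d - 2)) + x \<bullet> e (d - 1) + x \<bullet> e d) / (2 ^ (d - 1) + 1) \<le> 1}
     \<and> integer_hull (Delta d e) = convex hull
       ({0} \<union> (\<lambda>i. (2 ^ i) *\<^sub>R e i) ` {1..d - 2}
        \<union> {(2 ^ (d - 1) - 1) *\<^sub>R e (d - 1), (2 ^ (d - 1) + 1) *\<^sub>R e d,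
           e (d - 1) + (2 ^ (d - 1)) *\<^sub>R e d, e (d - 2) + (2 ^ (d - 1) - 1) *\<^sub>R e d})
     \<and> (\<exists>Q. triangular_prism Q \<and> iterated_pyramid (d - 3) Q (integer_hull (Delta d e)))
     \<and> lattice_polytope (integer_hull (Delta d e))
     \<and> aff_dim (integer_hull (Delta d e)) = int d
     \<and> hollow (integer_hull (Delta d e))
     \<and> \<not> (\<exists>P :: (real ^ 'n) set. lattice_polytope P \<and> aff_dim P = int d \<and> hollow P \<and>
            integer_hull (Delta d e) \<subset> P)
     \<and> convex_body (Delta d e) \<and> hollow (Delta d e)
     \<and> integer_hull (Delta d e) \<subset> Delta d e"
proof -
  interpret basis_listing d e
    using assms by unfold_locales
  have hull: "integer_hull (Delta d e) = truncation"
    by (simp add: integer_hull_Delta truncation_eq_hull)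
  show ?thesis
    unfolding hull
  proof (intro conjI)
    show "truncation = {x. (\<forall>i\<in>{1..d}. 0 \<le> x \<bullet> e i) \<and>
        (\<Sum>i = 1..d - 2. (x \<bullet> e i) / 2 ^ i) + (x \<bullet> e (d - 1)) / (2 ^ (d - 1) - 1)
          + (x \<bullet> e d) / (2 ^ (d - 1) + 1 + alpha d) \<le> 1 \<and>
        (\<Sum>i = 1..d - 3. (x \<bullet> e i) / 2 ^ i)
          + (2 * (x \<bullet> e (d - 2)) + x \<bullet> e (d - 1) + x \<bullet> e d) / (2 ^ (d - 1) + 1) \<le> 1}"
      unfolding first_eq unfolding pow_d1 truncation_def second_def head_def ..
    show "truncation = convex hull
       ({0} \<union> (\<lambda>i. (2 ^ i) *\<^sub>R e i) ` {1..d - 2}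
        \<union> {(2 ^ (d - 1) - 1) *\<^sub>R e (d - 1), (2 ^ (d - 1) + 1) *\<^sub>R e d,
           e (d - 1) + (2 ^ (d - 1)) *\<^sub>R e d, e (d - 2) + (2 ^ (d - 1) - 1) *\<^sub>R e d})"
      unfolding vertices_eq by (rule truncation_eq_hull)
    show "\<exists>Q. triangular_prism Q \<and> iterated_pyramid (d - 3) Q truncation"
      using triangular_prism_base iterated_pyramid_hull[of "d - 3"]
      unfolding truncation_eq_hull vertices_def by blast
    show "lattice_polytope truncation"
      unfolding lattice_polytope_def using finite_vertices vertices_int_lattice truncation_eq_hull
      by blast
    show "hollow truncation"
      using hollow_Delta interior_mono[OF truncation_subset_Delta] by (auto simp: hollow_def)
    show "\<not> (\<exists>P. lattice_polytope P \<and> aff_dim P = int d \<and> hollow P \<and> truncation \<subset> P)"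
      using truncation_maximal by blast
  qed (use Delta_hull aff_dim_truncation convex_body_Delta hollow_Delta truncation_psubset_Delta
      in simp_all)
qed

end
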